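(* $$\inf_{x\in(0,\frac{1}{\beta-1})}\big\{\dim_H(\Sigma_\beta(x))\big\}\to 1\quad\text{as }\beta\to1,$$ where the limit is taken over $\beta\in(1,2)$.
   Context: For $1<\beta<2$ and $x\in[0,\frac{1}{\beta-1}]$, let $\Sigma_\beta(x)=\{(\epsilon_n)_{n=1}^{\infty}\in\{0,1\}^{\mathbb{N}}:\sum_{n=1}^{\infty}\epsilon_n\beta^{-n}=x\}$ be the set of $\beta$-expansions of $x$. The space $\{0,1\}^{\mathbb{N}}$ carries the metric $d(x,y)=2^{-n(x,y)}$ if $x\neq y$, where $n(x,y)=\inf\{i\ge 1:x_i\neq y_i\}$, and $d(x,x)=0$. $\dim_H$ denotes Hausdorff dimension with respect to this metric. *)

theory Defs
  imports "HOL-Analysis.Analysis"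
begin

section \<open>Hausdorff dimension in a metric space\<close>

context Metric_space
begin

text \<open>As \<^const>\<open>diameter\<close>; only meaningful for bounded sets.\<close>

definition mdiameter :: "'a set \<Rightarrow> real" where
  "mdiameter U = (if U = {} then 0 else SUP (x, y)\<in>U \<times> U. d x y)"

text \<open>
  The term \<open>(diam U)\<^sup>s\<close>. The empty set always contributes \<open>0\<close>, and \<open>0\<^sup>0 = 1\<close> for
  nonempty sets, so that the zero-dimensional measure is counting measure
  (\<open>0 powr 0\<close> is \<open>0\<close> in the library).
\<close>

definition diam_power :: "real \<Rightarrow> 'a set \<Rightarrow> real" where
  "diam_power s U = (if U = {} then 0 else if s = 0 then 1 else mdiameter U powr s)"

definition delta_cover :: "real \<Rightarrow> 'a set \<Rightarrow> (nat \<Rightarrow> 'a set) \<Rightarrow> bool" where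
  "delta_cover \<delta> S U \<longleftrightarrow> (\<forall>i. mbounded (U i) \<and> mdiameter (U i) \<le> \<delta>) \<and> S \<subseteq> (\<Union>i. U i)"

definition hausdorff_premeasure :: "real \<Rightarrow> real \<Rightarrow> 'a set \<Rightarrow> ennreal" where
  "hausdorff_premeasure s \<delta> S = (INF U\<in>{U. delta_cover \<delta> S U}. \<Sum>i. ennreal (diam_power s (U i)))"

definition hausdorff_measure :: "real \<Rightarrow> 'a set \<Rightarrow> ennreal" where
  "hausdorff_measure s S = (SUP \<delta>\<in>{0<..}. hausdorff_premeasure s \<delta> S)"

definition hausdorff_dim :: "'a set \<Rightarrow> ennreal" where
  "hausdorff_dim S = (INF s\<in>{s. 0 \<le> s \<and> hausdorff_measure s S = 0}. ennreal s)"

end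


section \<open>Binary sequences and \<open>\<beta>\<close>-expansions\<close>

text \<open>
  A point of \<open>{0,1}\<^sup>\<nat>\<close> is a function of type \<^typ>\<open>nat \<Rightarrow> bool\<close>. Since \<^typ>\<open>nat\<close> starts
  at \<open>0\<close>, the \<open>n\<close>-th digit (\<open>n \<ge> 1\<close>) of \<open>\<epsilon>\<close> is \<open>\<epsilon> (n - 1)\<close>; this is the reason for the
  occurrences of \<^const>\<open>Suc\<close> below.
\<close>

definition first_diff :: "(nat \<Rightarrow> bool) \<Rightarrow> (nat \<Rightarrow> bool) \<Rightarrow> nat" where
  "first_diff x y = Suc (LEAST i. x i \<noteq> y i)"

definition binseq_dist :: "(nat \<Rightarrow> bool) \<Rightarrow> (nat \<Rightarrow> bool) \<Rightarrow> real" where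
  "binseq_dist x y = (if x = y then 0 else 1 / 2 ^ first_diff x y)"

definition beta_expansions :: "real \<Rightarrow> real \<Rightarrow> (nat \<Rightarrow> bool) set" where
  "beta_expansions \<beta> x = {\<epsilon>. (\<lambda>n. of_bool (\<epsilon> n) / \<beta> ^ Suc n) sums x}"

lemma first_diff_ultra:
  assumes "x \<noteq> z" "x \<noteq> y" "y \<noteq> z"
  shows "min (first_diff x y) (first_diff y z) \<le> first_diff x z"
proof -
  define k where "k = (LEAST i. x i \<noteq> z i)"
  have "\<exists>i. x i \<noteq> z i"
    using assms(1) by blast
  then have "x k \<noteq> z k"
    unfolding k_def by (rule LeastI_ex)
  then have "x k \<noteq> y k \<or> y k \<noteq> z k"
    by auto
  then have "(LEAST i. x i \<noteq> y i) \<le> k \<or> (LEAST i. y i \<noteq> z i) \<le> k"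
    using Least_le[of "\<lambda>i. x i \<noteq> y i" k] Least_le[of "\<lambda>i. y i \<noteq> z i" k] by blast
  then show ?thesis
    unfolding first_diff_def k_def[symmetric] by auto
qed

interpretation binseq: Metric_space UNIV binseq_dist
proof
  show "0 \<le> binseq_dist x y" for x y
    by (simp add: binseq_dist_def)
  show "binseq_dist x y = binseq_dist y x" for x y
    by (simp add: binseq_dist_def first_diff_def eq_commute)
  show "binseq_dist x y = 0 \<longleftrightarrow> x = y" for x y
    by (simp add: binseq_dist_def)
  show "binseq_dist x z \<le> binseq_dist x y + binseq_dist y z" for x y z
  proof (cases "x = y \<or> y = z \<or> x = z")
    case True
    then show ?thesis
      by (auto simp: binseq_dist_def)
  next
    case False
    have anti: "(1::real) / 2 ^ n \<le> 1 / 2 ^ m" if "m \<le> n" for m n :: nat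
      using that by (simp add: frac_le)
    have "first_diff x y \<le> first_diff x z \<or> first_diff y z \<le> first_diff x z"
      using first_diff_ultra[of x z y] False by auto
    then have "1 / 2 ^ first_diff x z \<le> (1::real) / 2 ^ first_diff x y
        \<or> 1 / 2 ^ first_diff x z \<le> (1::real) / 2 ^ first_diff y z"
      using anti by blast
    moreover have "0 \<le> (1::real) / 2 ^ first_diff x y" "0 \<le> (1::real) / 2 ^ first_diff y z"
      by simp_all
    ultimately have "1 / 2 ^ first_diff x z
        \<le> (1::real) / 2 ^ first_diff x y + 1 / 2 ^ first_diff y z"
      by linarith
    then show ?thesis
      using False by (simp add: binseq_dist_def)
  qed
qed

end

theory Submission
  imports Defs "HOL-Real_Asymp.Real_Asymp"
begin

text \<open>
  Every subset of the sequence space has dimension at most \<open>1\<close>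
  (\<open>binseq_hausdorff_dim_le_1\<close>), so only a lower bound that is uniform in \<open>x\<close> is at stake.

  Measured from the centre \<open>c = 1 / (2 (\<beta> - 1))\<close> of the interval \<open>[0, 1 / (\<beta> - 1)]\<close>, the
  remainder of an expansion evolves by \<open>u \<mapsto> \<beta> u + 1/2 - \<epsilon>\<close>, and a digit sequence is an
  expansion of \<open>x\<close> as soon as its orbit stays bounded (\<open>beta_expansions_if_bounded\<close>). For
  \<open>\<beta>\<close> close to \<open>1\<close> this is nearly a walk with steps \<open>\<plusminus>1/2\<close>, so a block of \<open>2 m\<close> digits with
  exactly \<open>m\<close> ones almost returns to its starting point. If it starts in \<open>[-1, 1]\<close>, it ends in
  \<open>[-5/4, 5/4]\<close>, and a single further digit, chosen by the sign of \<open>u\<close>, leads back to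
  \<open>[-1, 1]\<close>. Hence the balanced blocks can be chosen freely forever
  (\<open>steer_block_bounded\<close>): among \<open>2 m + 1\<close> digits there are \<open>(2 m) choose m\<close> choices. Since
  \<open>(2 m) choose m \<ge> 4 ^ m / (2 m)\<close>, for each \<open>s < 1\<close> this exceeds \<open>2 powr (s (2 m + 1))\<close> once
  \<open>m\<close> is large (\<open>exists_block_length\<close>); the closeness of \<open>\<beta>\<close> to \<open>1\<close> that is needed depends
  on \<open>m\<close> alone.

  To turn the count into a dimension, a real \<open>t \<in> [0, 1)\<close> is written in base
  \<open>M = (2 m) choose m\<close>, and its digits select the free blocks. Expansions of \<open>x\<close> that agree
  on \<open>K\<close> blocks then come from reals at distance at most \<open>1 / M ^ K\<close>, so the inverse of this
  map is Hoelder continuous of exponent \<open>s\<close>. Pulling a cover of the expansions back to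
  \<open>[0, 1)\<close> and comparing with Lebesgue measure gives dimension at least \<open>s\<close>
  (\<open>hausdorff_dim_ge\<close>). Finally, an \<open>x\<close> that is not within \<open>1\<close> of \<open>c\<close> is brought there by
  finitely many digits, and prepending digits only changes the Hoelder constant.
\<close>

section \<open>Bounds for Hausdorff dimension\<close>

lemma (in Metric_space) dist_le_mdiameter:
  assumes "mbounded U" "x \<in> U" "y \<in> U"
  shows "d x y \<le> mdiameter U"
proof -
  obtain B where B: "\<forall>x\<in>U. \<forall>y\<in>U. d x y \<le> B"
    using assms(1) unfolding mbounded_alt by blast
  have "d x y \<le> (SUP (x, y)\<in>U \<times> U. d x y)"
    by (rule cSUP_upper2[where x = "(x, y)"]) (use assms B in \<open>auto intro!: bdd_aboveI2[where M = B]\<close>)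
  then show ?thesis
    using assms by (auto simp: mdiameter_def)
qed

lemma (in Metric_space) mdiameter_le:
  assumes "\<And>x y. x \<in> U \<Longrightarrow> y \<in> U \<Longrightarrow> d x y \<le> B" "0 \<le> B"
  shows "mdiameter U \<le> B"
  unfolding mdiameter_def using assms by (auto intro!: cSUP_least)

text \<open>
  The mass distribution principle in the form of an inverse Hoelder bound: the preimage under
  \<open>h\<close> of a set of diameter \<open>D\<close> lies in an interval of length \<open>2 C D powr s\<close>, and the
  preimages of a cover must have total length at least \<open>1\<close>. An exponent \<open>r < s\<close> is handled by the same bound, as
  \<open>D powr s \<le> D powr r\<close> for \<open>D \<le> 1\<close>.
\<close>

lemma (in Metric_space) hausdorff_dim_ge:
  fixes h :: "real \<Rightarrow> 'a"
  assumes s: "0 < s"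
    and h: "\<And>t. t \<in> {0..<1} \<Longrightarrow> h t \<in> S"
    and C: "0 < C"
    and holder: "\<And>t t'. t \<in> {0..<1} \<Longrightarrow> t' \<in> {0..<1} \<Longrightarrow> \<bar>t - t'\<bar> \<le> C * d (h t) (h t') powr s"
  shows "ennreal s \<le> hausdorff_dim S"
  unfolding hausdorff_dim_def
proof (rule INF_greatest)
  fix r assume "r \<in> {r. 0 \<le> r \<and> hausdorff_measure r S = 0}"
  then have r: "0 \<le> r" "hausdorff_measure r S = 0"
    by auto
  show "ennreal s \<le> ennreal r"
  proof (rule ccontr)
    assume "\<not> ennreal s \<le> ennreal r"
    then have rs: "r < s"
      by (meson ennreal_leI not_le)
    have cover: "ennreal (1 / (2 * C)) \<le> (\<Sum>i. ennreal (diam_power r (U i)))"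
      if U: "delta_cover 1 S U" for U
    proof -
      define P where "P i = {t \<in> {0..<1}. h t \<in> U i}" for i
      \<comment> \<open>\<open>P i\<close> need not be measurable, so an interval around one of its points replaces it.\<close>
      define I where "I i = (if P i = {} then {} else
        let t = (SOME t. t \<in> P i) in {t - C * diam_power r (U i) .. t + C * diam_power r (U i)})" for i
      have pow_nonneg: "0 \<le> diam_power r (U i)" for i
        by (auto simp: diam_power_def)
      have I_em: "emeasure lborel (I i) \<le> ennreal (2 * C) * ennreal (diam_power r (U i))" for i
        using pow_nonneg[of i] C
        by (auto simp: I_def Let_def ennreal_mult[symmetric] intro!: ennreal_leI)
      have PI: "P i \<subseteq> I i" for i
      proof
        fix t assume t: "t \<in> P i"
        define a where "a = (SOME t. t \<in> P i)"
        have a: "a \<in> P i"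
          unfolding a_def using t by (rule someI)
        have D: "d (h t) (h a) \<le> mdiameter (U i)" "mdiameter (U i) \<le> 1"
          using U t a by (auto simp: delta_cover_def P_def intro!: dist_le_mdiameter)
        have "d (h t) (h a) powr s \<le> mdiameter (U i) powr s"
          using D s by (intro powr_mono2) auto
        also have "\<dots> \<le> diam_power r (U i)"
        proof (cases "r = 0")
          case True
          have "0 \<le> mdiameter (U i)"
            by (rule order_trans[OF nonneg D(1)])
          then show ?thesis
            using True t s D by (auto simp: diam_power_def P_def powr_le1)
        next
          case False
          have "0 \<le> mdiameter (U i)"
            by (rule order_trans[OF nonneg D(1)])
          then show ?thesis
            using False t rs r D by (auto simp: diam_power_def P_def intro!: powr_mono')
        qed
        finally have "\<bar>t - a\<bar> \<le> C * diam_power r (U i)"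
          using holder[of t a] t a C by (auto simp: P_def intro: order_trans)
        then show "t \<in> I i"
          using t by (auto simp: I_def Let_def a_def[symmetric])
      qed
      have "{0..<1} \<subseteq> (\<Union>i. P i)"
        using h U by (fastforce simp: delta_cover_def P_def)
      also have "(\<Union>i. P i) \<subseteq> (\<Union>i. I i)"
        using PI by (rule UN_mono[OF subset_refl])
      finally have "{0..<1::real} \<subseteq> (\<Union>i. I i)" .
      then have "emeasure lborel {0..<1::real} \<le> emeasure lborel (\<Union>i. I i)"
        by (intro emeasure_mono sets.countable_UN) (auto simp: I_def Let_def)
      also have "\<dots> \<le> (\<Sum>i. emeasure lborel (I i))"
        by (intro emeasure_subadditive_countably) (auto simp: I_def Let_def)
      also have "\<dots> \<le> (\<Sum>i. ennreal (2 * C) * ennreal (diam_power r (U i)))"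
        by (intro suminf_le I_em) auto
      also have "\<dots> = ennreal (2 * C) * (\<Sum>i. ennreal (diam_power r (U i)))"
        by simp
      finally have "1 \<le> ennreal (2 * C) * (\<Sum>i. ennreal (diam_power r (U i)))"
        by simp
      then have "ennreal (1 / (2 * C)) * 1
          \<le> ennreal (1 / (2 * C)) * (ennreal (2 * C) * (\<Sum>i. ennreal (diam_power r (U i))))"
        by (rule mult_left_mono) simp
      also have "\<dots> = (\<Sum>i. ennreal (diam_power r (U i)))"
        using C by (simp add: mult.assoc[symmetric] ennreal_mult[symmetric] del: ennreal_suminf_cmult)
      finally show ?thesis
        by simp
    qed
    have "ennreal (1 / (2 * C)) \<le> hausdorff_premeasure r 1 S"
      unfolding hausdorff_premeasure_def by (rule INF_greatest) (use cover in auto)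
    also have "\<dots> \<le> hausdorff_measure r S"
      unfolding hausdorff_measure_def by (rule SUP_upper) auto
    finally show False
      using r C by (simp add: ennreal_eq_0_iff)
  qed
qed

lemma binseq_dist_le_if_agree:
  assumes "\<And>j. j < n \<Longrightarrow> x j = y j"
  shows "binseq_dist x y \<le> 1 / 2 ^ n"
proof (cases "x = y")
  case False
  then have "x (LEAST i. x i \<noteq> y i) \<noteq> y (LEAST i. x i \<noteq> y i)"
    using LeastI_ex[of "\<lambda>i. x i \<noteq> y i"] by blast
  then have "\<not> (LEAST i. x i \<noteq> y i) < n"
    using assms by blast
  then have "n \<le> first_diff x y"
    unfolding first_diff_def by linarith
  then show ?thesis
    using False by (auto simp: binseq_dist_def intro!: divide_left_mono power_increasing)
qed (simp add: binseq_dist_def)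

text \<open>
  The \<open>2 ^ n\<close> cylinders of length \<open>n\<close> have diameter at most \<open>1 / 2 ^ n\<close>; with exponent
  \<open>1 + e\<close> their contributions sum up to at most \<open>2 powr (- e n)\<close>, which tends to \<open>0\<close>.
\<close>

lemma binseq_hausdorff_dim_le_1: "binseq.hausdorff_dim S \<le> 1"
proof (rule ennreal_le_epsilon)
  fix e :: real assume e: "0 < e"
  have pre: "binseq.hausdorff_premeasure (1 + e) \<delta> S = 0" if \<delta>: "0 < \<delta>" for \<delta>
  proof -
    have bound: "binseq.hausdorff_premeasure (1 + e) \<delta> S \<le> ennreal ((1 / 2 powr e) ^ n)"
      if n: "1 / 2 ^ n \<le> \<delta>" for n
    proof -
      \<comment> \<open>The binary digits of \<open>i\<close> enumerate the words of length \<open>n\<close>.\<close>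
      define U :: "nat \<Rightarrow> (nat \<Rightarrow> bool) set" where
        "U i = (if i < 2 ^ n then {x. \<forall>j<n. x j = bit i j} else {})" for i
      have dia: "binseq.mdiameter (U i) \<le> 1 / 2 ^ n" for i
        by (rule binseq.mdiameter_le) (auto simp: U_def intro!: binseq_dist_le_if_agree split: if_splits)
      have "binseq.mbounded (U i)" for i
        unfolding binseq.mbounded_alt
        by (auto simp: U_def intro!: exI[of _ "1 / 2 ^ n"] binseq_dist_le_if_agree split: if_splits)
      moreover have "x \<in> (\<Union>i. U i)" for x
      proof -
        define i :: nat where "i = horner_sum of_bool 2 (map x [0..<n])"
        have "i < 2 ^ n"
          unfolding i_def using horner_sum_of_bool_2_less[of "map x [0..<n]"] by simp
        moreover have "\<forall>j<n. x j = bit i j"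
          unfolding i_def by (simp add: bit_horner_sum_bit_iff)
        ultimately show ?thesis
          by (auto simp: U_def)
      qed
      ultimately have "binseq.delta_cover \<delta> S U"
        using dia n order_trans unfolding binseq.delta_cover_def by blast
      then have "binseq.hausdorff_premeasure (1 + e) \<delta> S \<le> (\<Sum>i. ennreal (binseq.diam_power (1 + e) (U i)))"
        unfolding binseq.hausdorff_premeasure_def by (intro INF_lower) auto
      also have "\<dots> = (\<Sum>i<2 ^ n. ennreal (binseq.diam_power (1 + e) (U i)))"
        by (intro suminf_finite) (auto simp: U_def binseq.diam_power_def)
      also have "\<dots> \<le> (\<Sum>i<2 ^ n::nat. ennreal ((1 / 2 ^ n) powr (1 + e)))"
      proof (intro sum_mono ennreal_leI)
        fix i
        show "binseq.diam_power (1 + e) (U i) \<le> (1 / 2 ^ n) powr (1 + e)"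
        proof (cases "U i = {}")
          case False
          then obtain x where "x \<in> U i"
            by auto
          then have "0 \<le> binseq.mdiameter (U i)"
            using binseq.dist_le_mdiameter[of "U i" x x] \<open>\<And>i. binseq.mbounded (U i)\<close> by simp
          then show ?thesis
            using e dia[of i] by (auto simp: binseq.diam_power_def intro!: powr_mono2)
        qed (auto simp: binseq.diam_power_def)
      qed
      also have "\<dots> = ennreal (2 ^ n * (1 / 2 ^ n) powr (1 + e))"
        by (simp add: ennreal_of_nat_eq_real_of_nat ennreal_mult[symmetric])
      also have "2 ^ n * (1 / 2 ^ n) powr (1 + e) = (1 / 2 powr e :: real) ^ n"
        by (simp add: powr_add powr_divide powr_realpow[symmetric] powr_powr powr_minus
            power_divide mult.commute)
      finally show ?thesis .
    qed
    have small: "eventually (\<lambda>n. 1 / 2 ^ n \<le> \<delta>) sequentially"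
    proof -
      have "(\<lambda>n. 1 / 2 ^ n :: real) \<longlonglongrightarrow> 0"
        by real_asymp
      then show ?thesis
        using \<delta> by (metis (mono_tags, lifting) eventually_mono less_imp_le order_tendstoD(2))
    qed
    have "(1 :: real) < 2 powr e"
      using e by simp
    then have "(\<lambda>n. ennreal ((1 / 2 powr e) ^ n)) \<longlonglongrightarrow> ennreal 0"
      by (intro tendsto_ennrealI LIMSEQ_realpow_zero) auto
    then have "binseq.hausdorff_premeasure (1 + e) \<delta> S \<le> ennreal 0"
      by (rule tendsto_lowerbound) (use small bound in \<open>auto elim: eventually_mono\<close>)
    then show ?thesis
      by simp
  qed
  have "binseq.hausdorff_measure (1 + e) S = 0"
    unfolding binseq.hausdorff_measure_def using pre by (auto simp: image_constant_conv)
  then have "binseq.hausdorff_dim S \<le> ennreal (1 + e)"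
    unfolding binseq.hausdorff_dim_def by (intro INF_lower) (use e in auto)
  then show "binseq.hausdorff_dim S \<le> 1 + ennreal e"
    using e by simp
qed

text \<open>
  The hypothesis of \<open>hausdorff_dim_ge\<close> as a property of a set of sequences. Prepending a digit
  to all sequences halves the distances, so it preserves this property up to a factor
  \<open>2 powr s\<close> in \<open>C\<close>; for the dimension itself one would have to transform covers.
\<close>

definition holder_dominates_interval :: "real \<Rightarrow> (nat \<Rightarrow> bool) set \<Rightarrow> bool" where
  "holder_dominates_interval s S \<longleftrightarrow> (\<exists>C>0. \<exists>h. (\<forall>t\<in>{0..<1}. h t \<in> S) \<and>
    (\<forall>t\<in>{0..<1}. \<forall>t'\<in>{0..<1}. \<bar>t - t'\<bar> \<le> C * binseq_dist (h t) (h t') powr s))"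

lemma hausdorff_dim_ge_if_holder_dominates_interval:
  "0 < s \<Longrightarrow> holder_dominates_interval s S \<Longrightarrow> ennreal s \<le> binseq.hausdorff_dim S"
  unfolding holder_dominates_interval_def by (metis binseq.hausdorff_dim_ge)

section \<open>Expansions as bounded orbits\<close>

text \<open>
  With \<open>c\<close> the fixed point of \<open>u \<mapsto> \<beta> u - 1/2\<close>, the error of the \<open>n\<close>-th partial sum is
  \<open>(v n + c) / \<beta> ^ n\<close>. Hence any bound on the orbit suffices.
\<close>

lemma beta_expansions_if_bounded:
  fixes v :: "nat \<Rightarrow> real" and \<beta> x B :: real
  assumes \<beta>: "1 < \<beta>"
    and v0: "v 0 = x - 1 / (2 * (\<beta> - 1))"
    and step: "\<And>n. v (Suc n) = \<beta> * v n + 1 / 2 - of_bool (\<epsilon> n)"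
    and bounded: "\<And>n. \<bar>v n\<bar> \<le> B"
  shows "\<epsilon> \<in> beta_expansions \<beta> x"
proof -
  define c where "c = 1 / (2 * (\<beta> - 1))"
  have c: "(\<beta> - 1) * c = 1 / 2"
    using \<beta> by (simp add: c_def)
  have partial: "(\<Sum>k<n. of_bool (\<epsilon> k) / \<beta> ^ Suc k) = x - (v n + c) / \<beta> ^ n" for n
  proof (induction n)
    case 0
    then show ?case
      using v0 by (simp add: c_def)
  next
    case (Suc n)
    have "v (Suc n) + c = \<beta> * (v n + c) - of_bool (\<epsilon> n)"
      using c by (simp add: step algebra_simps)
    then have "(v (Suc n) + c) / \<beta> ^ Suc n = (v n + c) / \<beta> ^ n - of_bool (\<epsilon> n) / \<beta> ^ Suc n"
      using \<beta> by (simp add: diff_divide_distrib)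
    then show ?case
      using Suc by simp
  qed
  have "(\<lambda>n. (1 / \<beta>) ^ n) \<longlonglongrightarrow> 0"
    using \<beta> by (intro LIMSEQ_realpow_zero) auto
  then have lim0: "(\<lambda>n. (B + \<bar>c\<bar>) * (1 / \<beta>) ^ n) \<longlonglongrightarrow> 0"
    by (rule tendsto_mult_right_zero)
  have "\<bar>(v n + c) / \<beta> ^ n\<bar> \<le> (B + \<bar>c\<bar>) * (1 / \<beta>) ^ n" for n
  proof -
    have "\<bar>v n + c\<bar> \<le> B + \<bar>c\<bar>"
      using bounded[of n] by linarith
    then show ?thesis
      using \<beta> by (simp add: power_divide divide_right_mono)
  qed
  then have "(\<lambda>n. (v n + c) / \<beta> ^ n) \<longlonglongrightarrow> 0"
    using lim0 by (intro Lim_null_comparison[OF _ lim0]) auto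
  then have "(\<lambda>n. x - (v n + c) / \<beta> ^ n) \<longlonglongrightarrow> x - 0"
    by (intro tendsto_diff tendsto_const)
  then show ?thesis
    unfolding beta_expansions_def sums_def mem_Collect_eq partial by simp
qed

lemma beta_expansions_case_nat:
  fixes \<beta> x :: real
  assumes "1 < \<beta>" "\<epsilon> \<in> beta_expansions \<beta> (\<beta> * x - of_bool e)"
  shows "case_nat e \<epsilon> \<in> beta_expansions \<beta> x"
proof -
  have "(\<lambda>n. of_bool (\<epsilon> n) / \<beta> ^ Suc n / \<beta>) sums ((\<beta> * x - of_bool e) / \<beta>)"
    using assms(2) unfolding beta_expansions_def by (intro sums_divide) simp
  then have "(\<lambda>n. of_bool (case_nat e \<epsilon> n) / \<beta> ^ Suc n) sums
      ((\<beta> * x - of_bool e) / \<beta> + of_bool e / \<beta>)"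
    using sums_Suc[of "\<lambda>n. of_bool (case_nat e \<epsilon> n) / \<beta> ^ Suc n"] by (simp add: mult.commute)
  then show ?thesis
    using assms(1) by (simp add: beta_expansions_def diff_divide_distrib del: power_Suc)
qed

lemma binseq_dist_case_nat: "binseq_dist x y = 2 * binseq_dist (case_nat e x) (case_nat e y)"
proof (cases "x = y")
  case False
  then obtain i where i: "x i \<noteq> y i"
    by auto
  have "(LEAST i. case_nat e x i \<noteq> case_nat e y i) = Suc (LEAST i. x i \<noteq> y i)"
    using Least_Suc[of "\<lambda>i. case_nat e x i \<noteq> case_nat e y i" "Suc i"] i by simp
  moreover have "case_nat e x \<noteq> case_nat e y"
    using i by (metis nat.case(2))
  ultimately show ?thesis
    using False by (simp add: binseq_dist_def first_diff_def)
qed (simp add: binseq_dist_def)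

lemma holder_dominates_interval_prepend:
  fixes \<beta> s x :: real
  assumes "1 < \<beta>" "holder_dominates_interval s (beta_expansions \<beta> (\<beta> * x - of_bool e))"
  shows "holder_dominates_interval s (beta_expansions \<beta> x)"
proof -
  obtain C h where C: "0 < C" and h: "\<forall>t\<in>{0..<1}. h t \<in> beta_expansions \<beta> (\<beta> * x - of_bool e)"
    and holder: "\<And>t t'. t \<in> {0..<1} \<Longrightarrow> t' \<in> {0..<1} \<Longrightarrow> \<bar>t - t'\<bar> \<le> C * binseq_dist (h t) (h t') powr s"
    using assms(2) unfolding holder_dominates_interval_def by blast
  have "\<bar>t - t'\<bar> \<le> (C * 2 powr s) * binseq_dist (case_nat e (h t)) (case_nat e (h t')) powr s"
    if "t \<in> {0..<1}" "t' \<in> {0..<1}" for t t'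
    using holder[OF that] unfolding binseq_dist_case_nat[of "h t" "h t'" e]
    by (simp add: powr_mult mult.assoc)
  then show ?thesis
    unfolding holder_dominates_interval_def
    using C h beta_expansions_case_nat[OF assms(1)]
    by (intro exI[of _ "C * 2 powr s"] conjI exI[of _ "\<lambda>t. case_nat e (h t)"]) auto
qed

section \<open>Digits of a real number\<close>

definition base_digit :: "nat \<Rightarrow> real \<Rightarrow> nat \<Rightarrow> nat" where
  "base_digit M t k = nat \<lfloor>M ^ Suc k * t\<rfloor> mod M"

text \<open>
  The first \<open>k\<close> digits determine the integer part of \<open>M ^ k * t\<close>.
\<close>

lemma base_digit_close:
  assumes M: "0 < M" and t: "t \<in> {0..<1}" "t' \<in> {0..<1}"
    and eq: "\<And>j. j < k \<Longrightarrow> base_digit M t j = base_digit M t' j"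
  shows "\<bar>t - t'\<bar> \<le> 1 / M ^ k"
proof -
  have "nat \<lfloor>M ^ k * t\<rfloor> = nat \<lfloor>M ^ k * t'\<rfloor>"
    using eq
  proof (induction k)
    case 0
    then show ?case
      using t by (simp add: floor_eq_iff)
  next
    case (Suc k)
    have rec: "nat \<lfloor>M ^ Suc k * a\<rfloor> = nat \<lfloor>M ^ k * a\<rfloor> * M + base_digit M a k" if "0 \<le> a" for a :: real
    proof -
      have "\<lfloor>M ^ Suc k * a\<rfloor> div int M = \<lfloor>M ^ k * a\<rfloor>"
        using floor_divide_real_eq_div[of "int M" "M ^ Suc k * a"] M by simp
      then have "nat \<lfloor>M ^ Suc k * a\<rfloor> div M = nat \<lfloor>M ^ k * a\<rfloor>"
        using that by (metis nat_div_distrib' nat_int of_nat_0_le_iff)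
      then show ?thesis
        unfolding base_digit_def by (metis div_mult_mod_eq)
    qed
    show ?case
      using Suc rec[of t] rec[of t'] t by simp
  qed
  moreover have "0 \<le> \<lfloor>M ^ k * t\<rfloor>" "0 \<le> \<lfloor>M ^ k * t'\<rfloor>"
    using t by auto
  ultimately have "\<lfloor>M ^ k * t\<rfloor> = \<lfloor>M ^ k * t'\<rfloor>"
    using eq_nat_nat_iff by blast
  then have "\<bar>M ^ k * t - M ^ k * t'\<bar> \<le> 1"
    by linarith
  then have "M ^ k * \<bar>t - t'\<bar> \<le> 1"
    by (simp add: abs_mult right_diff_distrib[symmetric])
  then show ?thesis
    using M by (simp add: field_simps)
qed


section \<open>Balanced blocks with a correcting digit\<close>

text \<open>
  Telescoping \<open>u (i + 1) - u i = (\<beta> - 1) u i + (1/2 - e i)\<close> leaves the error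
  \<open>(\<beta> - 1) \<Sum> u i\<close> against the walk with steps \<open>1/2 - e i\<close>. The two claims support each
  other: the walk stays within \<open>m\<close>, so \<open>u\<close> stays within \<open>1 + m + 1/4\<close> as long as the error
  is at most \<open>1/4\<close>, and the hypothesis on \<open>\<beta>\<close> makes \<open>2 m\<close> steps of error \<open>(\<beta> - 1) (m + 2)\<close>
  add up to at most that.
\<close>

lemma block_drift:
  fixes u :: "nat \<Rightarrow> real" and m :: nat and \<beta> :: real
  assumes \<beta>: "1 < \<beta>" "(\<beta> - 1) * (8 * real m * (real m + 2)) \<le> 1"
    and u0: "\<bar>u 0\<bar> \<le> 1"
    and step: "\<And>i. i < 2 * m \<Longrightarrow> u (Suc i) = \<beta> * u i + 1 / 2 - of_bool (e i)"
    and j: "j \<le> 2 * m"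
  shows "\<bar>u j - u 0 - (\<Sum>i<j. 1 / 2 - of_bool (e i))\<bar> \<le> real j * ((\<beta> - 1) * (real m + 2))"
    and "\<bar>u j\<bar> \<le> real m + 2"
proof -
  define \<sigma> where "\<sigma> j = (\<Sum>i<j. 1 / 2 - of_bool (e i) :: real)" for j
  define \<eta> where "\<eta> = (\<beta> - 1) * (real m + 2)"
  have \<eta>: "0 \<le> \<eta>" "real (2 * m) * \<eta> \<le> 1 / 4"
    using \<beta> by (simp_all add: \<eta>_def mult_ac)
  have bound: "\<bar>u j\<bar> \<le> real m + 2" if "\<bar>u j - u 0 - \<sigma> j\<bar> \<le> real j * \<eta>" "j \<le> 2 * m" for j
  proof -
    have "\<bar>\<sigma> j\<bar> \<le> (\<Sum>i<j. 1 / 2)"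
      unfolding \<sigma>_def by (rule order_trans[OF sum_abs sum_mono]) simp
    then have "\<bar>\<sigma> j\<bar> \<le> m"
      using that(2) by simp
    moreover have "real j * \<eta> \<le> real (2 * m) * \<eta>"
      using that(2) \<eta> by (intro mult_right_mono of_nat_mono) auto
    ultimately show ?thesis
      using that(1) u0 \<eta>(2) by linarith
  qed
  have drift: "\<bar>u j - u 0 - \<sigma> j\<bar> \<le> real j * \<eta>" if "j \<le> 2 * m" for j
    using that
  proof (induction j)
    case (Suc j)
    have "\<bar>(\<beta> - 1) * u j\<bar> \<le> \<eta>"
      using bound[of j] Suc \<beta>(1) unfolding \<eta>_def by (simp add: abs_mult)
    moreover have "u (Suc j) - u 0 - \<sigma> (Suc j) = (u j - u 0 - \<sigma> j) + (\<beta> - 1) * u j"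
      using step[of j] Suc.prems by (simp add: \<sigma>_def algebra_simps)
    ultimately show ?case
      using Suc by (simp add: algebra_simps)
  qed (simp add: \<sigma>_def)
  show "\<bar>u j - u 0 - (\<Sum>i<j. 1 / 2 - of_bool (e i))\<bar> \<le> real j * ((\<beta> - 1) * (real m + 2))"
    using drift[OF j] unfolding \<sigma>_def \<eta>_def .
  show "\<bar>u j\<bar> \<le> real m + 2"
    using bound drift j by blast
qed

lemma balanced_block_end:
  fixes u :: "nat \<Rightarrow> real" and m :: nat and \<beta> :: real
  assumes \<beta>: "1 < \<beta>" "(\<beta> - 1) * (8 * real m * (real m + 2)) \<le> 1"
    and u0: "\<bar>u 0\<bar> \<le> 1"
    and step: "\<And>i. i < 2 * m \<Longrightarrow> u (Suc i) = \<beta> * u i + 1 / 2 - of_bool (e i)"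
    and balanced: "card {i \<in> {..<2 * m}. e i} = m"
  shows "\<bar>u (2 * m)\<bar> \<le> 5 / 4"
proof -
  have "(\<Sum>i<2 * m. of_bool (e i) :: real) = m"
    using balanced by (simp add: of_bool_def sum.If_cases Int_def)
  then have "(\<Sum>i<2 * m. 1 / 2 - of_bool (e i) :: real) = 0"
    by (simp add: sum_subtractf)
  moreover have "real (2 * m) * ((\<beta> - 1) * (real m + 2)) \<le> 1 / 4"
    using \<beta> by (simp add: algebra_simps)
  ultimately show ?thesis
    using block_drift(1)[of \<beta> m u e "2 * m"] \<beta> u0 step by simp
qed

text \<open>
  The centred orbit when each digit is chosen by a rule that sees the time and the current
  position.
\<close>

primrec steer :: "real \<Rightarrow> (nat \<Rightarrow> real \<Rightarrow> bool) \<Rightarrow> real \<Rightarrow> nat \<Rightarrow> real" where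
  "steer \<beta> e v 0 = v"
| "steer \<beta> e v (Suc n) = \<beta> * steer \<beta> e v n + 1 / 2 - of_bool (e n (steer \<beta> e v n))"

text \<open>
  Time is cut into blocks of length \<open>2 m + 1\<close>. The first \<open>2 m\<close> digits of block \<open>k\<close> are the
  indicator function of \<open>A k\<close>, whatever the position; the last one pushes towards \<open>0\<close>.
\<close>

definition block_digit :: "nat \<Rightarrow> (nat \<Rightarrow> nat set) \<Rightarrow> nat \<Rightarrow> real \<Rightarrow> bool" where
  "block_digit m A n u =
    (if n mod (2 * m + 1) < 2 * m then n mod (2 * m + 1) \<in> A (n div (2 * m + 1)) else 0 < u)"

lemma block_digit_free:
  assumes "i < 2 * m"
  shows "block_digit m A (k * (2 * m + 1) + i) u \<longleftrightarrow> i \<in> A k"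
proof -
  define N where "N = 2 * m + 1"
  have "i < N"
    using assms by (simp add: N_def)
  then have "(k * N + i) mod N = i" "(k * N + i) div N = k"
    by simp_all
  then show ?thesis
    using assms unfolding block_digit_def N_def[symmetric] by simp
qed

lemma block_digit_correcting:
  "block_digit m A (k * (2 * m + 1) + 2 * m) u \<longleftrightarrow> 0 < u"
proof -
  have "(k * N + i) mod N = i" if "i < N" for i N :: nat
    using that by simp
  from this[of "2 * m" "2 * m + 1"] show ?thesis
    unfolding block_digit_def by simp
qed

text \<open>
  The orbit is in \<open>[-1, 1]\<close> at the start of every block: a balanced block leads to
  \<open>[-5/4, 5/4]\<close>, and as \<open>\<beta> \<le> 6/5\<close>, the correcting digit maps this into
  \<open>[-1, 1]\<close>, because \<open>6/5 * 5/4 - 1/2 = 1\<close>.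
\<close>

lemma steer_block_bounded:
  fixes m :: nat and \<beta> v :: real
  assumes \<beta>: "1 < \<beta>" "(\<beta> - 1) * (8 * real m * (real m + 2)) \<le> 1"
    and m: "1 \<le> m"
    and v: "\<bar>v\<bar> \<le> 1"
    and A: "\<And>k. A k \<subseteq> {..<2 * m}" "\<And>k. card (A k) = m"
  shows "\<bar>steer \<beta> (block_digit m A) v n\<bar> \<le> real m + 2"
proof -
  define N where "N = 2 * m + 1"
  define y where "y = steer \<beta> (block_digit m A) v"
  have step: "y (k * N + Suc i) = \<beta> * y (k * N + i) + 1 / 2 - of_bool (i \<in> A k)" if "i < 2 * m" for k i
    using block_digit_free[OF that, of A k] by (simp add: y_def N_def)
  have "1 * 3 \<le> real m * (real m + 2)"
    using m by (intro mult_mono) auto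
  then have "24 \<le> 8 * real m * (real m + 2)"
    by linarith
  then have "(\<beta> - 1) * 24 \<le> (\<beta> - 1) * (8 * real m * (real m + 2))"
    using \<beta>(1) by (intro mult_left_mono) auto
  then have "(\<beta> - 1) * 24 \<le> 1"
    using \<beta>(2) by (rule order_trans)
  then have \<beta>_le: "\<beta> \<le> 6 / 5"
    by (simp add: field_simps)
  have block: "\<bar>y (k * N)\<bar> \<le> 1" for k
  proof (induction k)
    case 0
    then show ?case
      using v by (simp add: y_def)
  next
    case (Suc k)
    have "{i \<in> {..<2 * m}. i \<in> A k} = A k"
      using A(1) by blast
    then have end_block: "\<bar>y (k * N + 2 * m)\<bar> \<le> 5 / 4"
      using balanced_block_end[of \<beta> m "\<lambda>i. y (k * N + i)" "\<lambda>i. i \<in> A k"] \<beta> Suc step A(2) by simp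
    define z where "z = y (k * N + 2 * m)"
    have "Suc k * N = Suc (k * N + 2 * m)"
      by (simp add: N_def)
    then have eq: "y (Suc k * N) = \<beta> * z + 1 / 2 - of_bool (0 < z)"
      using block_digit_correcting[of m A k] by (simp only: y_def z_def steer.simps N_def)
    have "\<beta> * \<bar>z\<bar> \<le> 6 / 5 * (5 / 4)"
      using end_block \<beta>_le \<beta>(1) unfolding z_def by (intro mult_mono) auto
    then have z: "\<bar>\<beta> * z\<bar> \<le> 3 / 2"
      using \<beta>(1) by (simp add: abs_mult)
    show ?case
    proof (cases "0 < z")
      case True
      then have "0 \<le> \<beta> * z"
        using \<beta>(1) by simp
      then show ?thesis
        using z True unfolding eq by simp
    next
      case False
      then have "\<beta> * z \<le> 0"
        using \<beta>(1) by (simp add: mult_le_0_iff)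
      then show ?thesis
        using z False unfolding eq by simp
    qed
  qed
  define k i where "k = n div N" and "i = n mod N"
  have n: "n = k * N + i"
    unfolding k_def i_def by simp
  have "i < N"
    unfolding i_def by (rule mod_less_divisor) (simp add: N_def)
  then have i: "i \<le> 2 * m"
    by (simp add: N_def)
  have "\<bar>y (k * N + i)\<bar> \<le> real m + 2"
    by (rule block_drift(2)[of \<beta> m "\<lambda>i. y (k * N + i)" "\<lambda>i. i \<in> A k"]) (use \<beta> block step i in auto)
  then show ?thesis
    by (simp add: n y_def)
qed

text \<open>
  Two expansions that first differ at index \<open>l\<close> share \<open>K = l div N\<close> full blocks, where
  \<open>N = 2 m + 1\<close>, so their parameters differ by at most \<open>1 / M ^ K \<le> 2 powr (- s N K)\<close>. As
  \<open>N K \<ge> (l + 1) - N\<close> and the distance is \<open>1 / 2 ^ (l + 1)\<close>, the incomplete last block costs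
  the constant \<open>2 powr (s N)\<close>.
\<close>

lemma holder_dominates_interval_central:
  fixes m :: nat and \<beta> s x :: real
  defines "M \<equiv> (2 * m) choose m"
  assumes \<beta>: "1 < \<beta>" "(\<beta> - 1) * (8 * real m * (real m + 2)) \<le> 1"
    and m: "1 \<le> m"
    and s: "0 < s" "2 powr (s * (2 * real m + 1)) \<le> real M"
    and x: "\<bar>x - 1 / (2 * (\<beta> - 1))\<bar> \<le> 1"
  shows "holder_dominates_interval s (beta_expansions \<beta> x)"
proof -
  define N where "N = 2 * m + 1"
  have N: "0 < N" and NM: "2 powr (s * real N) \<le> real M"
    using s by (simp_all add: N_def algebra_simps)
  have "1 < 2 powr (s * real N)"
    using s N by simp
  then have M: "1 < M"
    using NM by linarith
  have "finite {B. B \<subseteq> {..<2 * m} \<and> card B = m}"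
    by (rule finite_subset[of _ "Pow {..<2 * m}"]) auto
  from ex_bij_betw_nat_finite[OF this]
  obtain W where W: "bij_betw W {0..<M} {B. B \<subseteq> {..<2 * m} \<and> card B = m}"
    using n_subsets[of "{..<2 * m}" m] unfolding M_def by auto
  define A where "A t k = W (base_digit M t k)" for t k
  have A: "A t k \<subseteq> {..<2 * m}" "card (A t k) = m" for t k
  proof -
    have "base_digit M t k \<in> {0..<M}"
      using M by (simp add: base_digit_def)
    then have "A t k \<in> {B. B \<subseteq> {..<2 * m} \<and> card B = m}"
      unfolding A_def using W bij_betwE by blast
    then show "A t k \<subseteq> {..<2 * m}" "card (A t k) = m"
      by auto
  qed
  define y where "y t = steer \<beta> (block_digit m (A t)) (x - 1 / (2 * (\<beta> - 1)))" for t
  define h where "h t n = block_digit m (A t) n (y t n)" for t n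
  have h: "h t \<in> beta_expansions \<beta> x" for t
  proof (rule beta_expansions_if_bounded[OF \<beta>(1)])
    show "y t 0 = x - 1 / (2 * (\<beta> - 1))"
      by (simp add: y_def)
    show "y t (Suc n) = \<beta> * y t n + 1 / 2 - of_bool (h t n)" for n
      by (simp add: y_def h_def)
    show "\<bar>y t n\<bar> \<le> real m + 2" for n
      unfolding y_def by (rule steer_block_bounded[OF \<beta> m x A])
  qed
  have close: "\<bar>t - t'\<bar> \<le> 1 / real M ^ K"
    if t: "t \<in> {0..<1}" "t' \<in> {0..<1}" and agree: "\<And>n. n < K * N \<Longrightarrow> h t n = h t' n" for t t' K
  proof -
    have "base_digit M t k = base_digit M t' k" if k: "k < K" for k
    proof -
      have "i \<in> A t k \<longleftrightarrow> i \<in> A t' k" if i: "i < 2 * m" for i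
      proof -
        have "Suc k * N \<le> K * N"
          using k by (intro mult_le_mono1) simp
        then have "k * N + i < K * N"
          using i by (simp add: N_def)
        then have "h t (k * N + i) = h t' (k * N + i)"
          by (rule agree)
        then show ?thesis
          using block_digit_free[OF i] by (simp add: h_def N_def)
      qed
      then have "A t k = A t' k"
        using A(1) by blast
      moreover have "base_digit M t k \<in> {0..<M}" "base_digit M t' k \<in> {0..<M}"
        using M by (simp_all add: base_digit_def)
      ultimately show ?thesis
        using bij_betw_imp_inj_on[OF W] unfolding A_def by (metis inj_onD)
    qed
    then show ?thesis
      using base_digit_close[of M t t' K] t M by simp
  qed
  have holder: "\<bar>t - t'\<bar> \<le> 2 powr (s * real N) * binseq_dist (h t) (h t') powr s"
    if t: "t \<in> {0..<1}" "t' \<in> {0..<1}" for t t'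
  proof (cases "h t = h t'")
    case True
    then have "\<bar>t - t'\<bar> \<le> (1 / real M) ^ K" for K
      using close[OF t, of K] by (simp add: power_divide)
    moreover have "(\<lambda>K. (1 / real M) ^ K) \<longlonglongrightarrow> 0"
      using M by (intro LIMSEQ_realpow_zero) auto
    ultimately have "\<bar>t - t'\<bar> \<le> 0"
      by (intro tendsto_lowerbound[of _ 0 sequentially]) auto
    then show ?thesis
      using True by simp
  next
    case False
    define l where "l = (LEAST i. h t i \<noteq> h t' i)"
    define K where "K = l div N"
    have "h t n = h t' n" if "n < l" for n
      using not_less_Least[of n "\<lambda>i. h t i \<noteq> h t' i"] that unfolding l_def by blast
    moreover have "K * N \<le> l"
      by (simp add: K_def)
    ultimately have "\<bar>t - t'\<bar> \<le> 1 / real M ^ K"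
      by (intro close[OF t]) auto
    also have "\<dots> \<le> 1 / (2 powr (s * real N)) ^ K"
      using NM M by (intro divide_left_mono power_mono mult_pos_pos) auto
    also have "\<dots> = 2 powr (- (s * (real K * real N)))"
      by (simp add: powr_realpow[symmetric] powr_powr powr_minus divide_inverse algebra_simps)
    also have "\<dots> \<le> 2 powr (s * real N - s * real (Suc l))"
    proof -
      have "Suc l \<le> K * N + N"
        using N by (metis K_def Suc_leI div_mult_mod_eq mod_less_divisor nat_add_left_cancel_less)
      then have "real (Suc l) \<le> real K * real N + real N"
        by (metis of_nat_add of_nat_le_iff of_nat_mult)
      then have "s * real (Suc l) \<le> s * (real K * real N + real N)"
        using s by (intro mult_left_mono) auto
      then show ?thesis
        by (simp add: algebra_simps)
    qed
    also have "\<dots> = 2 powr (s * real N) * (1 / 2 ^ Suc l) powr s"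
      by (simp add: powr_diff powr_divide powr_realpow[symmetric] powr_powr mult.commute del: power_Suc of_nat_Suc)
    also have "1 / 2 ^ Suc l = binseq_dist (h t) (h t')"
      using False by (simp add: binseq_dist_def first_diff_def l_def)
    finally show ?thesis .
  qed
  show ?thesis
    unfolding holder_dominates_interval_def
    using h holder by (intro exI[of _ "2 powr (s * real N)"] conjI exI[of _ h]) auto
qed

text \<open>
  While \<open>x\<close> is further than \<open>1\<close> from the centre \<open>c\<close>, the digit pushing towards \<open>c\<close> multiplies
  the distance \<open>c - \<bar>x - c\<bar>\<close> to the boundary by \<open>\<beta>\<close>; as this is positive for an interior
  point, it is at least \<open>c - 1\<close> after finitely many steps.
\<close>

lemma holder_dominates_interval_interior:
  fixes m :: nat and \<beta> s x :: real
  assumes \<beta>: "1 < \<beta>" "(\<beta> - 1) * (8 * real m * (real m + 2)) \<le> 1"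
    and m: "1 \<le> m"
    and s: "0 < s" "2 powr (s * (2 * real m + 1)) \<le> real ((2 * m) choose m)"
    and x: "x \<in> {0<..<1 / (\<beta> - 1)}"
  shows "holder_dominates_interval s (beta_expansions \<beta> x)"
proof -
  define c where "c = 1 / (2 * (\<beta> - 1))"
  have c: "(\<beta> - 1) * c = 1 / 2"
    using \<beta> by (simp add: c_def)
  have main: "holder_dominates_interval s (beta_expansions \<beta> x)"
    if "c - 1 \<le> \<beta> ^ q * (c - \<bar>x - c\<bar>)" for x q
    using that
  proof (induction q arbitrary: x)
    case 0
    then show ?case
      using holder_dominates_interval_central[OF \<beta> m s, of x] by (simp add: c_def)
  next
    case (Suc q)
    show ?case
    proof (cases "\<bar>x - c\<bar> \<le> 1")
      case True
      then show ?thesis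
        using holder_dominates_interval_central[OF \<beta> m s, of x] by (simp add: c_def)
    next
      case False
      define x' where "x' = \<beta> * x - of_bool (c < x)"
      have eq: "x' - c = \<beta> * (x - c) + 1 / 2 - of_bool (c < x)"
        using c by (simp add: x'_def algebra_simps)
      have "1 * 1 \<le> \<beta> * \<bar>x - c\<bar>"
        using \<beta>(1) False by (intro mult_mono) auto
      then have ge: "1 \<le> \<beta> * \<bar>x - c\<bar>"
        by simp
      have "\<bar>x' - c\<bar> = \<beta> * \<bar>x - c\<bar> - 1 / 2"
      proof (cases "c < x")
        case True
        then have "\<bar>x - c\<bar> = x - c"
          by simp
        then show ?thesis
          using True ge unfolding eq by simp
      next
        case False
        then have "\<bar>x - c\<bar> = - (x - c)"
          by simp
        then show ?thesis
          using False ge unfolding eq by (simp only: mult_minus_right) simp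
      qed
      then have "c - \<bar>x' - c\<bar> = \<beta> * (c - \<bar>x - c\<bar>)"
        using c by (simp add: algebra_simps)
      then have "holder_dominates_interval s (beta_expansions \<beta> x')"
        using Suc by (intro Suc.IH) (simp add: mult_ac)
      then show ?thesis
        unfolding x'_def by (rule holder_dominates_interval_prepend[OF \<beta>(1)])
    qed
  qed
  have "1 / (\<beta> - 1) = 2 * c"
    by (simp add: c_def divide_simps)
  then have pos: "0 < c - \<bar>x - c\<bar>"
    using x by auto
  obtain q where "(c - 1) / (c - \<bar>x - c\<bar>) < \<beta> ^ q"
    using real_arch_pow \<beta>(1) by blast
  then have "c - 1 \<le> \<beta> ^ q * (c - \<bar>x - c\<bar>)"
    using pos by (simp add: field_simps)
  then show ?thesis
    by (rule main)
qed

text \<open>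
  Restricting to balanced words costs only the factor \<open>2 m\<close> in the count, which the
  exponential gap \<open>2 powr (2 (1 - s) m)\<close> absorbs.
\<close>

lemma exists_block_length:
  fixes s :: real
  assumes "s < 1"
  shows "\<exists>m\<ge>1. 2 powr (s * (2 * real m + 1)) \<le> real ((2 * m) choose m)"
proof -
  define a where "a = 1 - s"
  have a: "0 < a"
    using assms by (simp add: a_def)
  have "eventually (\<lambda>m::nat. 2 * real m \<le> 2 powr (2 * a * real m - 1)) sequentially"
    using a by real_asymp
  then have "eventually (\<lambda>m::nat. 2 powr (s * (2 * real m + 1)) \<le> 4 ^ m / (2 * real m) \<and> 1 \<le> m) sequentially"
    using eventually_ge_at_top[of "1::nat"]
  proof eventually_elim
    case (elim m)
    have "2 powr (s * (2 * real m + 1)) * (2 * real m)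
        \<le> 2 powr (s * (2 * real m + 1)) * 2 powr (2 * a * real m - 1)"
      using elim by (intro mult_left_mono) auto
    also have "\<dots> = 2 powr (2 * real m - a)"
      by (simp add: powr_add[symmetric] a_def algebra_simps)
    also have "\<dots> \<le> 2 powr real (2 * m)"
      using a by simp
    also have "\<dots> = 4 ^ m"
      by (subst powr_realpow) (simp_all add: power_mult)
    finally show ?case
      using elim by (simp add: pos_le_divide_eq)
  qed
  from eventually_happens[OF this] obtain m where m: "2 powr (s * (2 * real m + 1)) \<le> 4 ^ m / (2 * real m)" "1 \<le> m"
    by auto
  then show ?thesis
    using central_binomial_lower_bound[of m] by (intro exI[of _ m]) auto
qed

section \<open>The limit\<close>

theorem mainTheorem3:
  shows "((\<lambda>\<beta>::real. INF x\<in>{0<..<1 / (\<beta> - 1)}. binseq.hausdorff_dim (beta_expansions \<beta> x))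
           \<longlongrightarrow> (1::ennreal)) (at 1 within {1<..<2})"
proof (rule order_tendstoI)
  fix a :: ennreal assume "1 < a"
  have "(INF x\<in>{0<..<1 / (\<beta> - 1)}. binseq.hausdorff_dim (beta_expansions \<beta> x)) \<le> 1"
    if "\<beta> \<in> {1<..<2}" for \<beta> :: real
    by (rule INF_lower2[of "1 / (2 * (\<beta> - 1))"])
      (use that in \<open>auto simp: binseq_hausdorff_dim_le_1 field_simps\<close>)
  then show "eventually (\<lambda>\<beta>. (INF x\<in>{0<..<1 / (\<beta> - 1)}. binseq.hausdorff_dim (beta_expansions \<beta> x)) < a)
      (at 1 within {1<..<2})"
    using \<open>1 < a\<close> by (auto simp: eventually_at_filter intro!: always_eventually intro: le_less_trans)
next
  fix a :: ennreal assume "a < 1"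
  then obtain s0 where s0: "a < s0" "s0 < 1"
    using dense by blast
  obtain s where s: "s0 = ennreal s" "0 \<le> s"
    using s0(2) by (cases s0) auto
  have s_pos: "0 < s" "s < 1"
    using s s0 by (auto intro: ccontr)
  obtain m where m: "1 \<le> m" "2 powr (s * (2 * real m + 1)) \<le> real ((2 * m) choose m)"
    using exists_block_length[OF s_pos(2)] by blast
  define \<delta> where "\<delta> = 1 / (8 * real m * (real m + 2))"
  have \<delta>: "0 < \<delta>"
    using m by (simp add: \<delta>_def)
  have "a < (INF x\<in>{0<..<1 / (\<beta> - 1)}. binseq.hausdorff_dim (beta_expansions \<beta> x))"
    if \<beta>: "1 < \<beta>" "\<beta> - 1 < \<delta>" for \<beta> :: real
  proof -
    have "(\<beta> - 1) * (8 * real m * (real m + 2)) \<le> \<delta> * (8 * real m * (real m + 2))"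
      using \<beta> by (intro mult_right_mono) auto
    also have "\<dots> = 1"
      using m by (simp add: \<delta>_def)
    finally have "ennreal s \<le> binseq.hausdorff_dim (beta_expansions \<beta> x)" if "x \<in> {0<..<1 / (\<beta> - 1)}" for x
      using holder_dominates_interval_interior[OF \<beta>(1) _ m(1) s_pos(1) _ that] m(2)
      by (intro hausdorff_dim_ge_if_holder_dominates_interval s_pos) auto
    then have "s0 \<le> (INF x\<in>{0<..<1 / (\<beta> - 1)}. binseq.hausdorff_dim (beta_expansions \<beta> x))"
      unfolding s by (rule INF_greatest)
    then show ?thesis
      using s0 by order
  qed
  then show "eventually (\<lambda>\<beta>. a < (INF x\<in>{0<..<1 / (\<beta> - 1)}. binseq.hausdorff_dim (beta_expansions \<beta> x)))
      (at 1 within {1<..<2})"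
    unfolding eventually_at using \<delta> by (intro exI[of _ \<delta>]) (auto simp: dist_real_def)
qed

end
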